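(* Let $\lambda=(\lambda_1,\ldots,\lambda_n)\in\mathbb{Z}^n$ be a partition, and suppose $1\leq i\leq k\leq n$. Then $$r_{i,k}^\lambda=(-1)^{i-k}\sum_D (-1)^{\# D}q_D^\lambda,$$ where the sum ranges over all decompositions $D=\{\beta_1,\ldots,\beta_\ell\}\subseteq\Phi^+$ of $\varepsilon_i-\varepsilon_k$, $\#D$ is the cardinality of $D$, $q_D^\lambda:=q_{\beta_1}^\lambda\cdots q_{\beta_\ell}^\lambda$ if $\#D\geq1$, $q_\emptyset^\lambda:=1$, and for $\beta_j=\varepsilon_r-\varepsilon_s$ we set $q_{\beta_j}^\lambda:=q_{\lambda_r-\lambda_s}$.
   Context: Let $x_1,x_2,\ldots$ be variables and define symmetric functions $q_m$ ($m\in\mathbb{Z}$) by $\prod_{i\ge1}\frac{1+zx_i}{1-zx_i}=\sum_{m\in\mathbb{Z}}q_mz^m$; so $q_0=1$ and $q_m=0$ for $m<0$. A partition is a weakly decreasing finite sequence of nonnegative integers. For a partition $\lambda$ and indices $i\le k$, the coefficients $r_{i,k}^\lambda$ are defined recursively by $r_{i,i}^\lambda:=1$ and, for $k>i$, $r_{i,k}^\lambda:=-\sum_{j=i}^{k-1}(-1)^{j-k}q_{\lambda_j-\lambda_k}r_{i,j}^\lambda$. Let $\Phi^+:=\{\varepsilon_a-\varepsilon_b\mid 1\leq a<b\leq n\}$ be the positive roots of the $A_{n-1}$ root system, where $\varepsilon_1,\ldots,\varepsilon_n$ are (linearly independent) formal symbols. For $i<k$, a decomposition of $\varepsilon_i-\varepsilon_k$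 is a subset $D\subseteq\Phi^+$ whose elements sum to $\varepsilon_i-\varepsilon_k$. The only decomposition of $\varepsilon_i-\varepsilon_i=0$ is the empty set. *)

theory Defs
  imports
    Complex_Main
    "HOL-Library.Multiset"
    "HOL-Library.Poly_Mapping"
    "HOL-Computational_Algebra.Formal_Power_Series"
begin

section \<open>Formal power series in infinitely many variables\<close>

text \<open>
  A formal power series in \<open>x\<^sub>0, x\<^sub>1, \<dots>\<close> is a family of coefficients indexed by the monomials; a
  monomial is represented by the finite multiset of the indices of its factors.
  Variables are numbered from \<open>0\<close>.
  The ring of symmetric functions lies inside this ring.
\<close>

typedef 'a mfps = "UNIV :: (nat multiset \<Rightarrow> 'a) set"
  morphisms mcoeff Abs_mfps by simp

setup_lifting type_definition_mfps

lemma mfps_eqI: "(\<And>A. mcoeff f A = mcoeff g A) \<Longrightarrow> f = g"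
  by transfer auto

lemma mcoeff_Abs_mfps [simp]: "mcoeff (Abs_mfps c) A = c A"
  by (simp add: Abs_mfps_inverse)

lemma finite_submultisets: "finite {B. B \<subseteq># (A :: 'b multiset)}"
proof (induction A)
  case (add x A)
  have "{B. B \<subseteq># add_mset x A} \<subseteq> {B. B \<subseteq># A} \<union> add_mset x ` {B. B \<subseteq># A}"
  proof
    fix B assume "B \<in> {B. B \<subseteq># add_mset x A}"
    then have B: "B \<subseteq># add_mset x A" by simp
    show "B \<in> {B. B \<subseteq># A} \<union> add_mset x ` {B. B \<subseteq># A}"
    proof (cases "x \<in># B")
      case True
      then obtain C where "B = add_mset x C" by (metis insert_DiffM)
      with B show ?thesis by auto
    next
      case False
      with B have "B \<subseteq># A"
        by (metis add_mset_remove_trivial diff_single_trivial diff_subset_eq_self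
            subset_eq_diff_conv subset_mset.trans add_mset_add_single)
      then show ?thesis by simp
    qed
  qed
  with add show ?case by (meson finite_UnI finite_imageI finite_subset)
qed simp

lemma finite_mset_splits: "finite {(B, C). B + C = (A :: 'b multiset)}"
proof -
  have "{(B, C). B + C = A} \<subseteq> {B. B \<subseteq># A} \<times> {B. B \<subseteq># A}" by auto
  then show ?thesis using finite_submultisets[of A] by (meson finite_SigmaI finite_subset)
qed

instantiation mfps :: (comm_ring_1) comm_ring_1
begin

lift_definition zero_mfps :: "'a mfps" is "\<lambda>_. 0" .
lift_definition one_mfps :: "'a mfps" is "\<lambda>A. if A = {#} then 1 else 0" .
lift_definition plus_mfps :: "'a mfps \<Rightarrow> 'a mfps \<Rightarrow> 'a mfps" is "\<lambda>f g A. f A + g A" .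
lift_definition minus_mfps :: "'a mfps \<Rightarrow> 'a mfps \<Rightarrow> 'a mfps" is "\<lambda>f g A. f A - g A" .
lift_definition uminus_mfps :: "'a mfps \<Rightarrow> 'a mfps" is "\<lambda>f A. - f A" .
lift_definition times_mfps :: "'a mfps \<Rightarrow> 'a mfps \<Rightarrow> 'a mfps"
  is "\<lambda>f g A. \<Sum>(B, C) | B + C = A. f B * g C" .

instance
proof
  fix a b c :: "'a mfps"
  show "a + b + c = a + (b + c)" by transfer (auto simp: algebra_simps)
  show "a + b = b + a" by transfer (auto simp: algebra_simps)
  show "0 + a = a" by transfer auto
  show "- a + a = 0" by transfer auto
  show "a - b = a + - b" by transfer auto
  show "(0 :: 'a mfps) \<noteq> 1" by transfer (metis zero_neq_one)
  show "(a + b) * c = a * c + b * c"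
    by transfer (auto simp: algebra_simps sum.distrib case_prod_unfold)
  show "a * b = b * a"
  proof (transfer, rule ext)
    fix a b :: "nat multiset \<Rightarrow> 'a" and A
    show "(\<Sum>(B, C) | B + C = A. a B * b C) = (\<Sum>(B, C) | B + C = A. b B * a C)"
      by (rule sum.reindex_bij_witness[of _ prod.swap prod.swap]) (auto simp: ac_simps)
  qed
  show "1 * a = a"
  proof (transfer, rule ext)
    fix a :: "nat multiset \<Rightarrow> 'a" and A
    have "(\<Sum>(B, C) | B + C = A. (if B = {#} then 1 else 0) * a C)
        = (\<Sum>(B, C)\<in>{({#} :: nat multiset, A)}. (if B = {#} then 1 else 0) * a C)"
      by (rule sum.mono_neutral_right) (auto simp: finite_mset_splits split: if_splits)
    then show "(\<Sum>(B, C) | B + C = A. (if B = {#} then 1 else 0) * a C) = a A" by simp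
  qed
  show "a * b * c = a * (b * c)"
  proof (transfer, rule ext)
    fix a b c :: "nat multiset \<Rightarrow> 'a" and A
    let ?S = "\<lambda>A. {(B, C). B + C = (A :: nat multiset)}"
    have "(\<Sum>(D, C) \<in> ?S A. (\<Sum>(B, B') \<in> ?S D. a B * b B') * c C)
        = (\<Sum>p \<in> ?S A. \<Sum>s \<in> ?S (fst p). a (fst s) * b (snd s) * c (snd p))"
      by (simp add: case_prod_unfold sum_distrib_right)
    also have "\<dots> = (\<Sum>(p, s) \<in> (SIGMA p:?S A. ?S (fst p)). a (fst s) * b (snd s) * c (snd p))"
      by (rule sum.Sigma) (auto simp: finite_mset_splits)
    also have "\<dots> = (\<Sum>(p, s) \<in> (SIGMA p:?S A. ?S (snd p)). a (fst p) * (b (fst s) * c (snd s)))"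
      by (rule sum.reindex_bij_witness[of _
            "\<lambda>((u, v), (s, t)). ((u + s, t), (u, s))" "\<lambda>((u, v), (s, t)). ((s, t + v), (t, v))"])
         (auto simp: algebra_simps)
    also have "\<dots> = (\<Sum>p \<in> ?S A. \<Sum>s \<in> ?S (snd p). a (fst p) * (b (fst s) * c (snd s)))"
      by (rule sum.Sigma[symmetric]) (auto simp: finite_mset_splits)
    also have "\<dots> = (\<Sum>(B, D) \<in> ?S A. a B * (\<Sum>(B', C) \<in> ?S D. b B' * c C))"
      by (simp add: case_prod_unfold sum_distrib_left)
    finally show "(\<Sum>(D, C) \<in> ?S A. (\<Sum>(B, B') \<in> ?S D. a B * b B') * c C)
        = (\<Sum>(B, D) \<in> ?S A. a B * (\<Sum>(B', C) \<in> ?S D. b B' * c C))" .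
  qed
qed

end

lift_definition mvar :: "nat \<Rightarrow> 'a::comm_ring_1 mfps"
  is "\<lambda>i A. if A = {#i#} then 1 else 0" .


section \<open>The symmetric functions \<open>q\<^sub>m\<close>\<close>

text \<open>
  Power series in \<open>z\<close> are univariate series (variable \<open>fps_X\<close>) over the ring above.
\<close>

definition q_factor :: "nat \<Rightarrow> int mfps fps" where
  "q_factor i = (1 + fps_X * fps_const (mvar i)) *
     fps_right_inverse (1 - fps_X * fps_const (mvar i)) 1"

text \<open>
  The infinite product is taken coefficientwise: the coefficient of a fixed monomial in a fixed
  power of \<open>z\<close> is the limit (in the discrete integers, hence the eventual value) of the
  corresponding coefficient of the finite products.
\<close>

definition q :: "int \<Rightarrow> int mfps" where
  "q m = (if m < 0 then 0
          else Abs_mfps (\<lambda>A. lim (\<lambda>N. mcoeff (fps_nth (\<Prod>i<N. q_factor i) (nat m)) A)))"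


section \<open>The coefficients \<open>r\<^sub>i\<^sub>k\<close>\<close>

text \<open>
  A partition \<open>(\<lambda>\<^sub>1, \<dots>, \<lambda>\<^sub>n)\<close> is a function of which only the values on \<open>{1..n}\<close> matter.
\<close>

definition is_partition :: "nat \<Rightarrow> (nat \<Rightarrow> int) \<Rightarrow> bool" where
  "is_partition n lam \<longleftrightarrow> antimono_on {1..n} lam \<and> (\<forall>i\<in>{1..n}. 0 \<le> lam i)"

text \<open>The sign \<open>(-1)\<^bsup>j-k\<^esup>\<close> is written with the nonnegative exponent \<open>k - j\<close>.\<close>

fun r :: "(nat \<Rightarrow> int) \<Rightarrow> nat \<Rightarrow> nat \<Rightarrow> int mfps" where
  "r lam i k = (if k = i then 1
     else - (\<Sum>j = i..<k. (-1) ^ (k - j) * q (lam j - lam k) * r lam i j))"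

declare r.simps [simp del]


section \<open>Roots and decompositions\<close>

definition eps :: "nat \<Rightarrow> (nat \<Rightarrow>\<^sub>0 int)" where
  "eps a = Poly_Mapping.single a 1"

definition pos_roots :: "nat \<Rightarrow> (nat \<Rightarrow>\<^sub>0 int) set" where
  "pos_roots n = {eps a - eps b | a b. 1 \<le> a \<and> a < b \<and> b \<le> n}"

text \<open>
  For \<open>i = k\<close> the only decomposition is the empty set; see \<open>decompositions_same\<close> below.
\<close>

definition decompositions :: "nat \<Rightarrow> nat \<Rightarrow> nat \<Rightarrow> (nat \<Rightarrow>\<^sub>0 int) set set" where
  "decompositions n i k = {D. D \<subseteq> pos_roots n \<and> (\<Sum>\<beta>\<in>D. \<beta>) = eps i - eps k}"

text \<open>
  A positive root determines the pair \<open>(r, s)\<close> with \<open>r < s\<close> (\<open>eps_diff_eq_iff\<close>), so the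
  description below has a unique solution (\<open>q_root_eq\<close>).
\<close>

definition q_root :: "(nat \<Rightarrow> int) \<Rightarrow> (nat \<Rightarrow>\<^sub>0 int) \<Rightarrow> int mfps" where
  "q_root lam \<beta> = (THE f. \<exists>r s. r < s \<and> \<beta> = eps r - eps s \<and> f = q (lam r - lam s))"

definition q_dec :: "(nat \<Rightarrow> int) \<Rightarrow> (nat \<Rightarrow>\<^sub>0 int) set \<Rightarrow> int mfps" where
  "q_dec lam D = (\<Prod>\<beta>\<in>D. q_root lam \<beta>)"


section \<open>The definitions are well posed\<close>

lemma mcoeff_simps [simp]:
  "mcoeff 0 A = (0::'a::comm_ring_1)"
  "mcoeff 1 A = (if A = {#} then 1 else (0::'a))"
  "mcoeff (f + g) A = mcoeff f A + mcoeff (g :: 'a mfps) A"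
  "mcoeff (- f) A = - mcoeff (f :: 'a mfps) A"
  by (transfer; simp)+

lemma mcoeff_sum: "mcoeff (\<Sum>j\<in>S. f j) A = (\<Sum>j\<in>S. mcoeff (f j :: 'a::comm_ring_1 mfps) A)"
  by (induction S rule: infinite_finite_induct) auto

lemma mcoeff_times_mvar:
  "mcoeff (f * mvar i) A = (if i \<in># A then mcoeff f (A - {#i#}) else (0::'a::comm_ring_1))"
proof transfer
  fix f :: "nat multiset \<Rightarrow> 'a" and i A
  have "(\<Sum>(B, C) | B + C = A. f B * (if C = {#i#} then 1 else 0))
      = (\<Sum>(B, C)\<in>(if i \<in># A then {(A - {#i#}, {#i#})} else {}). f B * (if C = {#i#} then 1 else 0))"
    by (rule sum.mono_neutral_right) (auto simp: finite_mset_splits split: if_splits)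
  then show "(\<Sum>(B, C) | B + C = A. f B * (if C = {#i#} then 1 else 0))
      = (if i \<in># A then f (A - {#i#}) else 0)" by auto
qed

lemma mcoeff_times_mvar_power:
  "mcoeff (f * mvar i ^ k) A =
     (if k \<le> count A i then mcoeff f (A - replicate_mset k i) else (0::'a::comm_ring_1))"
proof (induction k arbitrary: A)
  case (Suc k)
  have "mcoeff (f * mvar i ^ Suc k) A = mcoeff (f * mvar i ^ k * mvar i) A"
    by (simp add: ac_simps)
  also have "\<dots> = (if i \<in># A then mcoeff (f * mvar i ^ k) (A - {#i#}) else 0)"
    by (rule mcoeff_times_mvar)
  finally show ?case
    using Suc[of "A - {#i#}"]
    by (auto simp: not_in_iff count_greater_zero_iff[symmetric] simp del: count_greater_zero_iff)
qed simp

lemma q_factor_eq: "(1 - fps_X * fps_const (mvar i)) * q_factor i = 1 + fps_X * fps_const (mvar i)"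
proof -
  define u :: "int mfps fps" where "u = 1 - fps_X * fps_const (mvar i)"
  define v :: "int mfps fps" where "v = 1 + fps_X * fps_const (mvar i)"
  have "fps_nth u 0 * 1 = 1" by (simp only: u_def fps_sub_nth fps_one_nth fps_mult_nth_0 fps_X_nth mult_zero_left diff_zero mult_1_left simp_thms if_False if_True zero_neq_one)
  then have *: "u * fps_right_inverse u 1 = 1" by (rule fps_right_inverse)
  have "u * (v * fps_right_inverse u 1) = v * (u * fps_right_inverse u 1)"
    by (rule mult.left_commute)
  with * have "u * (v * fps_right_inverse u 1) = v" by (simp only: mult_1_right)
  then show ?thesis unfolding q_factor_def u_def v_def .
qed

lemma q_factor_nth: "fps_nth (q_factor i) k = (if k = 0 then 1 else 2 * mvar i ^ k)"
proof (induction k)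
  case 0
  show ?case using arg_cong[OF q_factor_eq[of i], of "\<lambda>f. fps_nth f 0"] by simp
next
  case (Suc k)
  have "fps_nth (q_factor i) (Suc k) - mvar i * fps_nth (q_factor i) k = (if k = 0 then mvar i else 0)"
    using arg_cong[OF q_factor_eq[of i], of "\<lambda>f. fps_nth f (Suc k)"]
    by (simp add: left_diff_distrib mult.assoc)
  then show ?case using Suc by (auto simp: algebra_simps split: if_splits)
qed

lemma mcoeff_prod_q_factor:
  "mcoeff (fps_nth (\<Prod>i<N. q_factor i) m) A =
     (if size A = m \<and> set_mset A \<subseteq> {..<N} then 2 ^ card (set_mset A) else 0)"
proof (induction N arbitrary: m A)
  case 0
  show ?case by auto
next
  case (Suc N)
  define c where "c = count A N"
  define B where "B = A - replicate_mset c N"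
  have "replicate_mset c N \<subseteq># A"
    using count_le_replicate_mset_subset_eq[of c A N] by (simp add: c_def)
  then have A: "A = B + replicate_mset c N"
    unfolding B_def by (rule subset_mset.diff_add[symmetric])
  have B: "N \<notin># B"
    by (simp add: not_in_iff B_def c_def)
  have "mcoeff (fps_nth (\<Prod>i<Suc N. q_factor i) m) A =
      (\<Sum>j=0..m. mcoeff (fps_nth (\<Prod>i<N. q_factor i) j * fps_nth (q_factor N) (m - j)) A)"
    by (simp add: fps_mult_nth mcoeff_sum)
  also have "\<dots> = (\<Sum>j=0..m. if m - j = c then (if c = 0 then 1 else 2) *
        (if size B = j \<and> set_mset B \<subseteq> {..<N} then 2 ^ card (set_mset B) else 0) else 0)"
  proof (rule sum.cong[OF refl])
    fix j assume "j \<in> {0..m}"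
    let ?P = "fps_nth (\<Prod>i<N. q_factor i) j"
    let ?k = "m - j"
    have *: "mcoeff (?P * mvar N ^ ?k) A = (if ?k = c then mcoeff ?P B else 0)"
    proof -
      have "N \<in># A - replicate_mset ?k N" if "?k < c"
        using that by (simp add: c_def in_diff_count)
      then have "mcoeff ?P (A - replicate_mset ?k N) = 0" if "?k < c"
        using that by (subst Suc) auto
      then show ?thesis unfolding mcoeff_times_mvar_power
        by (auto simp: c_def B_def)
    qed
    have "mcoeff (?P * fps_nth (q_factor N) ?k) A
        = (if ?k = 0 then 1 else 2) * mcoeff (?P * mvar N ^ ?k) A"
    proof (cases "?k = 0")
      case False
      have "mcoeff (?P * (2 * mvar N ^ ?k)) A = mcoeff (2 * (?P * mvar N ^ ?k)) A"
        by (subst mult.left_commute) (rule refl)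
      also have "\<dots> = 2 * mcoeff (?P * mvar N ^ ?k) A"
        by (simp only: mult_2 mcoeff_simps)
      finally show ?thesis using False by (simp only: q_factor_nth if_False)
    qed (simp only: q_factor_nth refl if_True power_0 mult_1_left)
    then show "mcoeff (?P * fps_nth (q_factor N) ?k) A = (if ?k = c then (if c = 0 then 1 else 2) *
        (if size B = j \<and> set_mset B \<subseteq> {..<N} then 2 ^ card (set_mset B) else 0) else 0)"
      using Suc.IH[of j B] * by simp
  qed
  also have "\<dots> = (\<Sum>j=0..m. if j = size B then (if size B + c = m \<and> set_mset B \<subseteq> {..<N}
        then (if c = 0 then 1 else 2) * 2 ^ card (set_mset B) else 0) else 0)"
    by (rule sum.cong) auto
  also have "\<dots> = (if size B + c = m \<and> set_mset B \<subseteq> {..<N}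
        then (if c = 0 then 1 else 2) * 2 ^ card (set_mset B) else 0)"
    by (simp add: sum.delta)
  also have "\<dots> = (if size A = m \<and> set_mset A \<subseteq> {..<Suc N} then 2 ^ card (set_mset A) else 0)"
  proof -
    have "set_mset B \<subseteq> {..<Suc N} \<longleftrightarrow> set_mset B \<subseteq> {..<N}"
      using B by (auto simp: less_Suc_eq)
    then show ?thesis using B by (auto simp: A)
  qed
  finally show ?case .
qed

lemma q_product_converges:
  "eventually (\<lambda>N. mcoeff (fps_nth (\<Prod>i<N. q_factor i) m) A = mcoeff (q (int m)) A) sequentially"
proof -
  let ?v = "if size A = m then 2 ^ card (set_mset A) else (0::int)"
  obtain M where M: "set_mset A \<subseteq> {..<M}"
    using finite_nat_set_iff_bounded[of "set_mset A"] by auto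
  have ev: "eventually (\<lambda>N. mcoeff (fps_nth (\<Prod>i<N. q_factor i) m) A = ?v) sequentially"
    using eventually_ge_at_top[of M]
  proof eventually_elim
    case (elim N)
    with M have "set_mset A \<subseteq> {..<N}" by auto
    then show ?case by (simp add: mcoeff_prod_q_factor)
  qed
  then have "(\<lambda>N. mcoeff (fps_nth (\<Prod>i<N. q_factor i) m) A) \<longlonglongrightarrow> ?v"
    by (rule tendsto_eventually)
  then have "mcoeff (q (int m)) A = ?v" unfolding q_def by (simp add: limI)
  with ev show ?thesis by simp
qed

lemma mcoeff_q: "mcoeff (q m) A = (if int (size A) = m then 2 ^ card (set_mset A) else 0)"
proof (cases "m < 0")
  case False
  then have m: "int (nat m) = m" by simp
  obtain M where M: "set_mset A \<subseteq> {..<M}"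
    using finite_nat_set_iff_bounded[of "set_mset A"] by auto
  from eventually_conj[OF q_product_converges[of "nat m" A] eventually_ge_at_top[of M]]
  obtain N where N: "mcoeff (fps_nth (\<Prod>i<N. q_factor i) (nat m)) A = mcoeff (q m) A" "N \<ge> M"
    unfolding m by (auto simp: eventually_sequentially)
  have "set_mset A \<subseteq> {..<N}" using M N(2) by auto
  moreover have "size A = nat m \<longleftrightarrow> int (size A) = m" using False by linarith
  ultimately show ?thesis using N(1) by (simp add: mcoeff_prod_q_factor)
qed (auto simp: q_def)

lemma q_0: "q 0 = 1"
  by (rule mfps_eqI) (auto simp: mcoeff_q)

lemma q_symmetric: "bij \<pi> \<Longrightarrow> mcoeff (q m) (image_mset \<pi> A) = mcoeff (q m) A"
  by (simp add: mcoeff_q card_image[OF inj_on_subset[OF bij_is_inj]])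

lemma eps_diff_eq_iff:
  assumes "a < b" "c < d"
  shows "eps a - eps b = eps c - eps d \<longleftrightarrow> a = c \<and> b = d"
proof
  assume "eps a - eps b = eps c - eps d"
  then have *: "Poly_Mapping.lookup (eps a - eps b) x = Poly_Mapping.lookup (eps c - eps d) x" for x
    by simp
  show "a = c \<and> b = d"
    using *[of a] *[of b] assms
    by (auto simp: eps_def lookup_minus lookup_single when_def split: if_splits)
qed simp

lemma q_root_eq: "a < b \<Longrightarrow> q_root lam (eps a - eps b) = q (lam a - lam b)"
  unfolding q_root_def by (rule the_equality) (auto simp: eps_diff_eq_iff)

lemma finite_pos_roots: "finite (pos_roots n)"
proof -
  have "pos_roots n \<subseteq> (\<lambda>(a, b). eps a - eps b) ` ({..n} \<times> {..n})"
    by (force simp: pos_roots_def)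
  then show ?thesis by (rule finite_subset) simp
qed

lemma finite_decompositions: "finite (decompositions n i k)"
  by (rule finite_subset[of _ "Pow (pos_roots n)"]) (auto simp: decompositions_def finite_pos_roots)

lemma lookup_sum_pm: "Poly_Mapping.lookup (\<Sum>b\<in>S. f b) x = (\<Sum>b\<in>S. Poly_Mapping.lookup (f b) x)"
  by (induction S rule: infinite_finite_induct) (auto simp: lookup_add)

lemma decompositions_same: "decompositions n i i = {{}}"
proof -
  have "D = {}" if D: "D \<subseteq> pos_roots n" "(\<Sum>\<beta>\<in>D. \<beta>) = 0" for D
  proof (rule ccontr)
    assume "D \<noteq> {}"
    have fin: "finite D" using D(1) finite_pos_roots finite_subset by blast
    define P where "P a \<longleftrightarrow> (\<exists>b>a. eps a - eps b \<in> D)" for a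
    obtain a0 where "P a0" using \<open>D \<noteq> {}\<close> D(1) unfolding P_def pos_roots_def by blast
    define a where "a = (LEAST a. P a)"
    have Pa: "P a" unfolding a_def by (rule LeastI) fact
    have least: "a \<le> c" if "P c" for c unfolding a_def by (rule Least_le) fact
    obtain b where b: "b > a" "eps a - eps b \<in> D" using Pa P_def by blast
    have "0 < (\<Sum>\<beta>\<in>D. Poly_Mapping.lookup \<beta> a)"
    proof (rule sum_pos2[OF fin b(2)])
      show "0 < Poly_Mapping.lookup (eps a - eps b) a"
        using b(1) by (simp add: eps_def lookup_minus lookup_single)
      fix \<beta> assume "\<beta> \<in> D"
      then obtain c d where cd: "c < d" "\<beta> = eps c - eps d" using D(1) by (auto simp: pos_roots_def)
      with \<open>\<beta> \<in> D\<close> have "a \<le> c" by (intro least) (auto simp: P_def)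
      with cd show "0 \<le> Poly_Mapping.lookup \<beta> a"
        by (simp add: eps_def lookup_minus lookup_single when_def)
    qed
    with D(2) show False by (simp flip: lookup_sum_pm)
  qed
  then show ?thesis by (auto simp: decompositions_def)
qed

end

theory Submission
  imports Defs
begin

text \<open>
  In a decomposition of \<open>\<epsilon>\<^sub>i - \<epsilon>\<^sub>k\<close> with \<open>i < k\<close>, the largest index at which a root ends must be \<open>k\<close>
  and the smallest index at which a root starts must be \<open>i\<close>, since nothing cancels there.
  Hence some root \<open>\<epsilon>\<^sub>j - \<epsilon>\<^sub>k\<close> with \<open>i \<le> j < k\<close> occurs; removing it leaves a decomposition of
  \<open>\<epsilon>\<^sub>i - \<epsilon>\<^sub>j\<close>, all of whose roots end at \<open>j\<close> or before, so \<open>j\<close> is determined. The signed sum over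
  decompositions therefore satisfies the recursion that defines \<open>r\<^sub>i\<^sub>k\<close>.
\<close>

lemma lookup_eps_diff:
  "Poly_Mapping.lookup (eps a - eps b) x = of_bool (x = a) - of_bool (x = b)"
  by (simp add: eps_def lookup_minus lookup_single when_def)

lemma decompositionsD:
  assumes "D \<in> decompositions n i k"
  shows "finite D"
    and "(\<Sum>\<beta>\<in>D. Poly_Mapping.lookup \<beta> x) = of_bool (x = i) - of_bool (x = k)"
proof -
  have "D \<subseteq> pos_roots n" using assms by (simp add: decompositions_def)
  then show "finite D" using finite_pos_roots finite_subset by blast
  have "(\<Sum>\<beta>\<in>D. \<beta>) = eps i - eps k" using assms by (simp add: decompositions_def)
  then show "(\<Sum>\<beta>\<in>D. Poly_Mapping.lookup \<beta> x) = of_bool (x = i) - of_bool (x = k)"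
    by (simp add: lookup_eps_diff flip: lookup_sum_pm)
qed

lemma decomposition_rootE:
  assumes "D \<in> decompositions n i k" and "\<beta> \<in> D"
  obtains a b where "a < b" "b \<le> n" "\<beta> = eps a - eps b"
  using assms by (auto simp: decompositions_def pos_roots_def)

text \<open>At the largest end \<open>m\<close> of a root in \<open>D\<close> no root can start, as
  it would end later still. The coordinates at \<open>m\<close> are therefore nonpositive and not
  all zero, while the total is negative only at \<open>k\<close>; so \<open>m = k\<close>.\<close>

lemma decomposition_end_le:
  assumes D: "D \<in> decompositions n i k" and "eps a - eps b \<in> D" and "a < b"
  shows "b \<le> k"
proof -
  \<comment> \<open>The bound by \<open>n\<close> makes \<open>E\<close> finite, so that
    \<open>Max E\<close> is meaningful.\<close>
  define E where "E = {d. d \<le> n \<and> (\<exists>c<d. eps c - eps d \<in> D)}"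
  have E: "d \<in> E" if cd: "eps c - eps d \<in> D" "c < d" for c d
  proof -
    obtain c' d' where "c' < d'" "d' \<le> n" "eps c - eps d = eps c' - eps d'"
      using D cd(1) by (rule decomposition_rootE)
    then show ?thesis using cd by (auto simp: E_def eps_diff_eq_iff)
  qed
  have "finite E" by (rule finite_subset[of _ "{..n}"]) (auto simp: E_def)
  define m where "m = Max E"
  have m: "d \<le> m" if "d \<in> E" for d
    using \<open>finite E\<close> that by (simp add: m_def)
  have "m \<in> E"
    unfolding m_def using \<open>finite E\<close> E[OF assms(2,3)] by (intro Max_in) auto
  then obtain c where c: "c < m" "eps c - eps m \<in> D" by (auto simp: E_def)
  have "0 < (\<Sum>\<beta>\<in>D. - Poly_Mapping.lookup \<beta> m)"
  proof (rule sum_pos2[OF decompositionsD(1)[OF D] c(2)])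
    show "0 < - Poly_Mapping.lookup (eps c - eps m) m"
      using c(1) by (simp add: lookup_eps_diff)
    fix \<beta> assume "\<beta> \<in> D"
    with D obtain c' d' where cd: "c' < d'" "d' \<le> n" "\<beta> = eps c' - eps d'"
      by (rule decomposition_rootE)
    with \<open>\<beta> \<in> D\<close> have "d' \<le> m" by (intro m E) auto
    with cd show "0 \<le> - Poly_Mapping.lookup \<beta> m"
      by (simp add: lookup_eps_diff)
  qed
  then have "m = k"
    by (simp add: sum_negf decompositionsD(2)[OF D] split: if_splits)
  with m[OF E[OF assms(2,3)]] show ?thesis by simp
qed

text \<open>Mirror image: at the smallest start no root can end, so the total there is positive,
  which happens only at \<open>i\<close>.\<close>

lemma decomposition_start_ge:
  assumes D: "D \<in> decompositions n i k" and "eps a - eps b \<in> D" and "a < b"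
  shows "i \<le> a"
proof -
  define P where "P c \<longleftrightarrow> (\<exists>d>c. eps c - eps d \<in> D)" for c
  have "P a" using assms(2,3) by (auto simp: P_def)
  define m where "m = (LEAST c. P c)"
  have "P m" unfolding m_def by (rule LeastI) fact
  have m: "m \<le> c" if "P c" for c unfolding m_def by (rule Least_le) fact
  obtain d where d: "m < d" "eps m - eps d \<in> D" using \<open>P m\<close> by (auto simp: P_def)
  have "0 < (\<Sum>\<beta>\<in>D. Poly_Mapping.lookup \<beta> m)"
  proof (rule sum_pos2[OF decompositionsD(1)[OF D] d(2)])
    show "0 < Poly_Mapping.lookup (eps m - eps d) m"
      using d(1) by (simp add: lookup_eps_diff)
    fix \<beta> assume "\<beta> \<in> D"
    with D obtain c' d' where cd: "c' < d'" "d' \<le> n" "\<beta> = eps c' - eps d'"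
      by (rule decomposition_rootE)
    with \<open>\<beta> \<in> D\<close> have "m \<le> c'" by (intro m) (auto simp: P_def)
    with cd show "0 \<le> Poly_Mapping.lookup \<beta> m"
      by (simp add: lookup_eps_diff)
  qed
  then have "m = i"
    by (simp add: decompositionsD(2)[OF D] split: if_splits)
  with m[OF \<open>P a\<close>] show ?thesis by simp
qed

text \<open>The total at \<open>k\<close> is -1, so some root is negative at \<open>k\<close>, which
  means that it ends there.\<close>

lemma decomposition_has_last_root:
  assumes D: "D \<in> decompositions n i k" and "i < k"
  obtains j where "i \<le> j" "j < k" "eps j - eps k \<in> D"
proof -
  have "(\<Sum>\<beta>\<in>D. Poly_Mapping.lookup \<beta> k) < 0"
    using \<open>i < k\<close> by (simp add: decompositionsD(2)[OF D])
  then obtain \<beta> where \<beta>: "\<beta> \<in> D" "Poly_Mapping.lookup \<beta> k < 0"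
    by (meson not_le sum_nonneg)
  from D \<beta>(1) obtain c d where cd: "c < d" "d \<le> n" "\<beta> = eps c - eps d"
    by (rule decomposition_rootE)
  with \<beta>(2) have "d = k" by (simp add: lookup_eps_diff split: if_splits)
  with cd \<beta>(1) decomposition_start_ge[OF D] show ?thesis by (intro that[of c]) auto
qed

text \<open>Guarantees that inserting a root ending at \<open>k\<close> really enlarges
  \<open>D\<close>.\<close>

lemma last_root_notin_decomposition:
  assumes "D \<in> decompositions n i j" "j < k" "c < k"
  shows "eps c - eps k \<notin> D"
  using decomposition_end_le[OF assms(1) _ assms(3)] assms(2) by auto

text \<open>Sums match because \<open>(eps i - eps j) + (eps j - eps k)\<close> telescopes;
  \<open>j\<close> can be recovered because the inserted root is the only one ending at
  \<open>k\<close>.\<close>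

lemma bij_betw_insert_last_root:
  assumes "1 \<le> i" "i < k" "k \<le> n"
  shows "bij_betw (\<lambda>(j, D). insert (eps j - eps k) D)
           (SIGMA j:{i..<k}. decompositions n i j) (decompositions n i k)"
proof (rule bij_betw_imageI)
  show "inj_on (\<lambda>(j, D). insert (eps j - eps k) D) (SIGMA j:{i..<k}. decompositions n i j)"
  proof (rule inj_onI, clarsimp)
    fix j D j' D'
    assume j: "i \<le> j" "j < k" "D \<in> decompositions n i j"
      and j': "i \<le> j'" "j' < k" "D' \<in> decompositions n i j'"
      and eq: "insert (eps j - eps k) D = insert (eps j' - eps k) D'"
    note nD = last_root_notin_decomposition[OF j(3,2)]
    note nD' = last_root_notin_decomposition[OF j'(3,2)]
    \<comment> \<open>\<open>D'\<close> has no root ending at \<open>k\<close>, so the left root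
      must be the one inserted on the right.\<close>
    have "eps j - eps k = eps j' - eps k" using eq nD'[OF j(2)] by blast
    then have "j = j'" using j(2) j'(2) by (simp add: eps_diff_eq_iff)
    with eq nD[OF j(2)] nD'[OF j'(2)] show "j = j' \<and> D = D'"
      by (simp add: insert_ident)
  qed
next
  show "(\<lambda>(j, D). insert (eps j - eps k) D) ` (SIGMA j:{i..<k}. decompositions n i j)
      = decompositions n i k" (is "?f ` ?S = _")
  proof
    show "?f ` ?S \<subseteq> decompositions n i k"
    proof clarsimp
      fix j D assume j: "i \<le> j" "j < k" and D: "D \<in> decompositions n i j"
      note last_root_notin_decomposition[OF D j(2) j(2)]
      moreover have "eps j - eps k \<in> pos_roots n"
        unfolding pos_roots_def using j assms by (blast intro: order_trans)
      ultimately show "insert (eps j - eps k) D \<in> decompositions n i k"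
        using D decompositionsD(1)[OF D] by (simp add: decompositions_def)
    qed
    show "decompositions n i k \<subseteq> ?f ` ?S"
    proof
      fix D assume D: "D \<in> decompositions n i k"
      then obtain j where j: "i \<le> j" "j < k" "eps j - eps k \<in> D"
        using \<open>i < k\<close> by (rule decomposition_has_last_root)
      have "D - {eps j - eps k} \<in> decompositions n i j"
        using D decompositionsD(1)[OF D] j(3)
        by (auto simp: decompositions_def sum_diff1)
      then show "D \<in> ?f ` ?S"
        using j by (intro image_eqI[of _ _ "(j, D - {eps j - eps k})"]) (auto simp: insert_absorb)
    qed
  qed
qed

text \<open>The last root adds one to the cardinality, hence the minus sign, and contributes the
  factor \<open>q (lam j - lam k)\<close>.\<close>

lemma signed_decomposition_sum_rec:
  assumes "1 \<le> i" "i < k" "k \<le> n"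
  shows "(\<Sum>D\<in>decompositions n i k. (-1) ^ card D * q_dec lam D)
       = - (\<Sum>j=i..<k. q (lam j - lam k) *
              (\<Sum>D\<in>decompositions n i j. (-1) ^ card D * q_dec lam D))"
proof -
  have "(\<Sum>D\<in>decompositions n i k. (-1) ^ card D * q_dec lam D)
      = (\<Sum>(j, D)\<in>(SIGMA j:{i..<k}. decompositions n i j).
           (-1) ^ card (insert (eps j - eps k) D) * q_dec lam (insert (eps j - eps k) D))"
    by (subst sum.reindex_bij_betw[OF bij_betw_insert_last_root[OF assms], symmetric])
       (simp add: case_prod_unfold)
  also have "\<dots> = (\<Sum>(j, D)\<in>(SIGMA j:{i..<k}. decompositions n i j).
           - (q (lam j - lam k) * ((-1) ^ card D * q_dec lam D)))"
  proof (rule sum.cong[OF refl], clarsimp)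
    fix j D assume j: "j < k" and D: "D \<in> decompositions n i j"
    show "(-1) ^ card (insert (eps j - eps k) D) * q_dec lam (insert (eps j - eps k) D)
        = - (q (lam j - lam k) * ((-1) ^ card D * q_dec lam D))"
      using last_root_notin_decomposition[OF D j j] decompositionsD(1)[OF D]
      by (simp add: q_dec_def q_root_eq[OF j] mult.left_commute)
  qed
  also have "\<dots> = (\<Sum>j=i..<k. \<Sum>D\<in>decompositions n i j.
           - (q (lam j - lam k) * ((-1) ^ card D * q_dec lam D)))"
    by (rule sum.Sigma[symmetric]) (auto simp: finite_decompositions)
  finally show ?thesis by (simp add: sum_negf sum_distrib_left)
qed

theorem proposition5p9:
  fixes n i k :: nat and lam :: "nat \<Rightarrow> int"
  assumes "is_partition n lam"
    and "1 \<le> i" and "i \<le> k" and "k \<le> n"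
  shows "r lam i k = (-1) ^ (k - i) * (\<Sum>D\<in>decompositions n i k. (-1) ^ card D * q_dec lam D)"
  using assms(3,4)
proof (induction k rule: less_induct)
  case (less k)
  let ?S = "\<lambda>j. \<Sum>D\<in>decompositions n i j. (-1) ^ card D * q_dec lam D"
  show ?case
  proof (cases "k = i")
    case True
    then show ?thesis by (subst r.simps) (simp add: decompositions_same q_dec_def)
  next
    case False
    with less.prems have "i < k" by simp
    have "r lam i k = - (\<Sum>j=i..<k. (-1) ^ (k - j) * q (lam j - lam k) * r lam i j)"
      using False by (subst r.simps) simp
    also have "\<dots> = - (\<Sum>j=i..<k. (-1) ^ (k - i) * (q (lam j - lam k) * ?S j))"
    proof (intro arg_cong[of _ _ uminus] sum.cong refl)
      fix j assume j: "j \<in> {i..<k}"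
      \<comment> \<open>The sign from the recursion and the one from the induction hypothesis
        combine to a sign independent of \<open>j\<close>, which then leaves the sum.\<close>
      have sign: "(-1) ^ (k - i) = (-1) ^ (k - j) * ((-1) ^ (j - i) :: int mfps)"
        using j by (simp flip: power_add)
      have "r lam i j = (-1) ^ (j - i) * ?S j"
        using j less.prems by (intro less.IH) auto
      then show "(-1) ^ (k - j) * q (lam j - lam k) * r lam i j
          = (-1) ^ (k - i) * (q (lam j - lam k) * ?S j)"
        unfolding sign by (simp only: ac_simps)
    qed
    also have "\<dots> = (-1) ^ (k - i) * - (\<Sum>j=i..<k. q (lam j - lam k) * ?S j)"
      by (simp add: sum_distrib_left)
    also have "\<dots> = (-1) ^ (k - i) * ?S k"
      using signed_decomposition_sum_rec[OF assms(2) \<open>i < k\<close> less.prems(2)] by simp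
    finally show ?thesis .
  qed
qed

end
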